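(* $\overline{\alpha}(K_n) = O(\log n)$; that is, there is a constant $C$ such that for all $n\ge 2$ there exist a straight-line drawing $\widetilde K_n$ of $K_n$ and an edge-ordering of it in which every non-crossing monotone path has length at most $C\log n$.
   Context: A geometric graph is a graph whose vertices are points in the plane in general position and whose edges are straight line segments joining these points; a straight-line drawing of a graph $G$ is a geometric graph isomorphic to $G$. An edge-ordering is a total order on the edges. In an edge-ordered graph, a path $v_1v_2\ldots v_k$ is increasing if $(v_iv_{i+1}) > (v_{i+1}v_{i+2})$ for all $i=1,\ldots,k-2$, decreasing if $(v_iv_{i+1}) < (v_{i+1}v_{i+2})$ for all $i$, and monotone if it is increasing or decreasing. Its length is its number of edges. A path in a geometric graph is non-crossing if no two of its edges cross. For a geometric graph $\widetilde G$, $\overline\alpha(\widetilde G)$ is the minimum, over all edge-orderings of $\widetilde G$, of the maximum length of a non-crossing monotone path in $\widetilde G$; $\overline\alpha(G)$ is the minimum of $\overline\alpha(\widetilde G)$ over all straight-line drawings $\widetilde G$ of $G$. *)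

theory Defs
  imports "HOL-Analysis.Analysis" "HOL-Library.Landau_Symbols"
begin

type_synonym 'a ugraph = "'a set \<times> 'a set set"
type_synonym point = "real \<times> real"

definition simple_graph :: "'a ugraph \<Rightarrow> bool" where
  "simple_graph G \<longleftrightarrow> finite (fst G) \<and> snd G \<subseteq> {{u, v} | u v. u \<in> fst G \<and> v \<in> fst G \<and> u \<noteq> v}"

definition graph_isomorphic :: "'a ugraph \<Rightarrow> 'b ugraph \<Rightarrow> bool" where
  "graph_isomorphic G H \<longleftrightarrow>
     (\<exists>f. bij_betw f (fst G) (fst H) \<and>
          (\<forall>u\<in>fst G. \<forall>v\<in>fst G. {u, v} \<in> snd G \<longleftrightarrow> {f u, f v} \<in> snd H))"

definition complete_graph :: "nat \<Rightarrow> nat ugraph" where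
  "complete_graph n = ({..<n}, {{u, v} | u v. u < n \<and> v < n \<and> u \<noteq> v})"

definition general_position :: "point set \<Rightarrow> bool" where
  "general_position V \<longleftrightarrow>
     (\<forall>a\<in>V. \<forall>b\<in>V. \<forall>c\<in>V. a \<noteq> b \<and> a \<noteq> c \<and> b \<noteq> c \<longrightarrow> \<not> collinear {a, b, c})"

text \<open>The edge \<open>{u, v}\<close> of a geometric graph stands for the closed segment between
  \<open>u\<close> and \<open>v\<close>, so a geometric graph is determined by its points and its pairs of points.\<close>

definition geometric_graph :: "point ugraph \<Rightarrow> bool" where
  "geometric_graph G \<longleftrightarrow> simple_graph G \<and> general_position (fst G)"

definition straight_line_drawing :: "point ugraph \<Rightarrow> 'a ugraph \<Rightarrow> bool" where
  "straight_line_drawing D G \<longleftrightarrow> geometric_graph D \<and> graph_isomorphic D G"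

text \<open>Two edges cross if they share a point interior to both. In general position, distinct
  edges with a common endpoint never do.\<close>

definition edges_cross :: "point set \<Rightarrow> point set \<Rightarrow> bool" where
  "edges_cross e f \<longleftrightarrow> e \<noteq> f \<and>
     (\<exists>a b c d. e = {a, b} \<and> f = {c, d} \<and> open_segment a b \<inter> open_segment c d \<noteq> {})"

definition edge_ordering :: "'a ugraph \<Rightarrow> 'a set rel \<Rightarrow> bool" where
  "edge_ordering G r \<longleftrightarrow> linear_order_on (snd G) r"

definition edge_less :: "'a set rel \<Rightarrow> 'a set \<Rightarrow> 'a set \<Rightarrow> bool" where
  "edge_less r e f \<longleftrightarrow> (e, f) \<in> r \<and> e \<noteq> f"

definition path_edge :: "'a list \<Rightarrow> nat \<Rightarrow> 'a set" where
  "path_edge p i = {p ! i, p ! Suc i}"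

definition path_in :: "'a ugraph \<Rightarrow> 'a list \<Rightarrow> bool" where
  "path_in G p \<longleftrightarrow> p \<noteq> [] \<and> distinct p \<and> set p \<subseteq> fst G \<and>
     (\<forall>i. Suc i < length p \<longrightarrow> path_edge p i \<in> snd G)"

definition path_length :: "'a list \<Rightarrow> nat" where
  "path_length p = length p - 1"

text \<open>In keeping with the source, a path is called increasing when its edges get smaller
  along the path. Since reversing a path swaps the two notions, monotonicity is unaffected.\<close>

definition increasing_path :: "'a set rel \<Rightarrow> 'a list \<Rightarrow> bool" where
  "increasing_path r p \<longleftrightarrow>
     (\<forall>i. Suc (Suc i) < length p \<longrightarrow> edge_less r (path_edge p (Suc i)) (path_edge p i))"

definition decreasing_path :: "'a set rel \<Rightarrow> 'a list \<Rightarrow> bool" where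
  "decreasing_path r p \<longleftrightarrow>
     (\<forall>i. Suc (Suc i) < length p \<longrightarrow> edge_less r (path_edge p i) (path_edge p (Suc i)))"

definition monotone_path :: "'a set rel \<Rightarrow> 'a list \<Rightarrow> bool" where
  "monotone_path r p \<longleftrightarrow> increasing_path r p \<or> decreasing_path r p"

definition noncrossing_path :: "point list \<Rightarrow> bool" where
  "noncrossing_path p \<longleftrightarrow>
     (\<forall>i j. Suc i < length p \<longrightarrow> Suc j < length p \<longrightarrow>
        \<not> edges_cross (path_edge p i) (path_edge p j))"

definition noncrossing_monotone_paths :: "point ugraph \<Rightarrow> point set rel \<Rightarrow> point list set" where
  "noncrossing_monotone_paths G r = {p. path_in G p \<and> noncrossing_path p \<and> monotone_path r p}"

text \<open>On \<^typ>\<open>nat\<close>, an infimum over a nonempty set is attained, and a supremum over a finite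
  nonempty set is its maximum. The set of paths of a finite graph with at least one vertex is
  finite, and nonempty because of the one-vertex paths.\<close>

definition alpha_bar_geometric :: "point ugraph \<Rightarrow> nat" where
  "alpha_bar_geometric G =
     (INF r\<in>{r. edge_ordering G r}. SUP p\<in>noncrossing_monotone_paths G r. path_length p)"

definition alpha_bar :: "'a ugraph \<Rightarrow> nat" where
  "alpha_bar G = (INF D\<in>{D. straight_line_drawing D G}. alpha_bar_geometric D)"

end

theory Submission imports Defs begin

text \<open>Place the vertices \<open>0, \<dots>, n - 1\<close> on the parabola \<open>y = x\<^sup>2\<close>. Give an edge
  the level \<open>l\<close> if the dyadic blocks of size \<open>2 ^ l\<close> are the smallest ones that contain both of
  its ends, and order edges first by level and then by the sum of the ends. A monotone path goes
  through the levels monotonically. If three consecutive edges \<open>ab\<close>, \<open>bc\<close>, \<open>cd\<close> had the same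
  level, then \<open>a, c\<close> would lie in one half of a block and \<open>b, d\<close> in the other, and monotonicity
  of the sums would give \<open>a < c\<close> and \<open>b < d\<close> (or both reversed), so that \<open>ab\<close> and \<open>cd\<close> cross.
  Hence each of the \<open>O(log n)\<close> levels contributes at most two edges.\<close>

section \<open>Points on the parabola and their crossing chords\<close>

definition parab :: "nat \<Rightarrow> point" where
  "parab k = (real k, (real k)\<^sup>2)"

text \<open>Defined on sets so that it applies to edges. For distinct \<open>i\<close> and
  \<open>j\<close> it is the position, counted from 1, of the highest binary digit in which they
  differ.\<close>

definition level :: "nat set \<Rightarrow> nat" where
  "level e = (LEAST l. \<exists>q. \<forall>x\<in>e. x div 2 ^ l = q)"

lemma inj_parab: "inj parab"
  by (auto simp: inj_def parab_def)

text \<open>Collinearity would make the Vandermonde product of the three abscissas vanish.\<close>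

lemma not_collinear_parab:
  assumes "a \<noteq> b" "a \<noteq> c" "b \<noteq> c"
  shows "\<not> collinear {parab a, parab b, parab c}"
proof
  assume "collinear {parab a, parab b, parab c}"
  then obtain u where u: "\<forall>x\<in>{parab a, parab b, parab c}. \<forall>y\<in>{parab a, parab b, parab c}. \<exists>c. x - y = c *\<^sub>R u"
    unfolding collinear_def by blast
  obtain s where s: "parab b - parab a = s *\<^sub>R u" using u by blast
  obtain t where t: "parab c - parab a = t *\<^sub>R u" using u by blast
  let ?a = "real a" and ?b = "real b" and ?c = "real c"
  obtain u1 u2 where uu: "u = (u1, u2)" by (cases u)
  have s': "?b - ?a = s * u1" "?b\<^sup>2 - ?a\<^sup>2 = s * u2" using s uu by (auto simp: parab_def)
  have t': "?c - ?a = t * u1" "?c\<^sup>2 - ?a\<^sup>2 = t * u2" using t uu by (auto simp: parab_def)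
  have "(?b - ?a) * (?c\<^sup>2 - ?a\<^sup>2) = (?c - ?a) * (?b\<^sup>2 - ?a\<^sup>2)"
    unfolding s' t' by simp
  then have "(?b - ?a) * (?c - ?a) * (?c - ?b) = 0"
    by (simp add: algebra_simps power2_eq_square)
  then show False using assms by simp
qed

lemma edges_cross_commute: "edges_cross e f \<longleftrightarrow> edges_cross f e"
  unfolding edges_cross_def by (metis Int_commute)

text \<open>Chords of a convex curve with interleaved ends cross; the common point is computed
  explicitly.\<close>

lemma edges_cross_parab:
  assumes "a < b" "b < c" "c < d"
  shows "edges_cross {parab a, parab c} {parab b, parab d}"
proof -
  define A B C D where "A = real a" "B = real b" "C = real c" "D = real d"
  note defs = this
  have lt: "A < B" "B < C" "C < D" using assms by (auto simp: defs)
  \<comment> \<open>The chord through abscissas \<open>x\<close> and \<open>y\<close> lies on the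
    line of slope \<open>x + y\<close> and intercept \<open>- x * y\<close>. Equating the lines for
    \<open>A, C\<close> and \<open>B, D\<close> gives this abscissa.\<close>
  define X where "X = (B * D - A * C) / (B + D - A - C)"
  have den: "B + D - A - C > 0" using lt by simp
  have X: "X * (B + D - A - C) = B * D - A * C" using den by (simp add: X_def)
  \<comment> \<open>This factorisation and the next place \<open>X\<close> strictly between
    \<open>B\<close> and \<open>C\<close>, hence inside both chords.\<close>
  have "(X - B) * (B + D - A - C) = (B - A) * (C - B)"
    using X by (simp add: algebra_simps)
  moreover have "(B - A) * (C - B) > 0" using lt by simp
  ultimately have XB: "B < X" using den by (metis diff_gt_0_iff_gt zero_less_mult_pos2)
  have "(C - X) * (B + D - A - C) = (D - C) * (C - B)"
    using X by (simp add: algebra_simps)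
  moreover have "(D - C) * (C - B) > 0" using lt by simp
  ultimately have XC: "X < C" using den by (metis diff_gt_0_iff_gt zero_less_mult_pos2)
  have chord: "(X, (x + y) * X - x * y) \<in> open_segment (x, x\<^sup>2) (y, y\<^sup>2)"
    if "x < X" "X < y" for x y :: real
  proof -
    define u where "u = (X - x) / (y - x)"
    have u: "0 < u" "u < 1" using that by (auto simp: u_def field_simps)
    have "u * (y - x) = X - x" using that by (simp add: u_def)
    then have eq: "X = (1 - u) * x + u * y" by (simp add: algebra_simps)
    have "(x + y) * X - x * y = (1 - u) * x\<^sup>2 + u * y\<^sup>2"
      unfolding eq by (simp add: algebra_simps power2_eq_square)
    with eq u that show ?thesis
      unfolding in_segment by (intro conjI exI[of _ u]) auto
  qed
  have "(X, (A + C) * X - A * C) \<in> open_segment (parab a) (parab c)"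
    using chord[of A C] lt XB XC by (simp add: parab_def defs)
  moreover have "(X, (B + D) * X - B * D) \<in> open_segment (parab b) (parab d)"
    using chord[of B D] lt XB XC by (simp add: parab_def defs)
  moreover have "(A + C) * X - A * C = (B + D) * X - B * D"
    using X by (simp add: algebra_simps)
  ultimately have "open_segment (parab a) (parab c) \<inter> open_segment (parab b) (parab d) \<noteq> {}"
    by auto
  moreover have "{parab a, parab c} \<noteq> {parab b, parab d}"
    using assms by (auto simp: doubleton_eq_iff parab_def)
  ultimately show ?thesis unfolding edges_cross_def by blast
qed

section \<open>Dyadic levels and crossings within one level\<close>

lemma level_pair: "level {i, j} = (LEAST l. i div 2 ^ l = j div 2 ^ l)"
  unfolding level_def by (rule arg_cong[where f = Least]) auto

lemma div_level: "i div 2 ^ level {i, j} = j div 2 ^ level {i, j}" for i j :: nat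
proof -
  \<comment> \<open>Any exponent that makes both quotients 0 would do; it only shows that the
    \<open>LEAST\<close> is attained.\<close>
  have "i div 2 ^ (i + j) = j div 2 ^ (i + j)"
    by (metis div_less le_add1 le_add2 le_less_trans less_exp)
  then show ?thesis unfolding level_pair by (rule LeastI)
qed

lemma level_pos: "i \<noteq> j \<Longrightarrow> 0 < level {i, j}"
  using div_level[of i j] by (cases "level {i, j}") auto

lemma level_le: "i < 2 ^ L \<Longrightarrow> j < 2 ^ L \<Longrightarrow> level {i, j} \<le> L"
  unfolding level_pair by (rule Least_le) simp

lemma div_below_level: "l < level {i, j} \<Longrightarrow> i div 2 ^ l \<noteq> j div 2 ^ l"
  unfolding level_pair by (rule not_less_Least)

text \<open>The block \<open>q\<close> of size \<open>2 ^ Suc l\<close> splits into the blocks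
  \<open>2 * q\<close> and \<open>2 * q + 1\<close> of half the size. By minimality of the level the
  two ends do not share a half.\<close>

lemma level_halves:
  assumes "level {a, b} = Suc l" and q: "q = a div 2 ^ Suc l"
  shows "(a div 2 ^ l = 2 * q \<and> b div 2 ^ l = 2 * q + 1) \<or>
    (b div 2 ^ l = 2 * q \<and> a div 2 ^ l = 2 * q + 1)"
proof -
  have halves: "x = 2 * q \<and> y = 2 * q + 1 \<or> y = 2 * q \<and> x = 2 * q + 1"
    if "q = x div 2" "q = y div 2" "x \<noteq> y" for x y :: nat
    using that by presburger
  have Suc_div: "x div 2 ^ Suc l = x div 2 ^ l div 2" for x :: nat
    by (simp only: power_Suc2 div_mult2_eq)
  have "a div 2 ^ Suc l = b div 2 ^ Suc l" using div_level[of a b] unfolding assms(1) .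
  then have "q = b div 2 ^ l div 2" unfolding q Suc_div .
  moreover have "q = a div 2 ^ l div 2" unfolding q Suc_div by (rule refl)
  moreover have "a div 2 ^ l \<noteq> b div 2 ^ l"
    by (rule div_below_level) (simp add: assms(1))
  ultimately show ?thesis using halves by blast
qed

lemma less_of_div_less: "x div m < y div m \<Longrightarrow> x < y" for x y m :: nat
  by (meson div_le_mono leD leI)

text \<open>Consecutive edges share a vertex, so all three lie in the same block and the path
  alternates between its halves. Everything in the lower half is below everything in the upper
  half.\<close>

lemma level_alternating:
  assumes "level {a, b} = l" "level {b, c} = l" "level {c, d} = l" "a \<noteq> b"
  shows "(a < b \<and> a < d \<and> c < b \<and> c < d) \<or> (b < a \<and> d < a \<and> b < c \<and> d < c)"
proof -
  obtain k where k: "l = Suc k" using level_pos[OF assms(4)] assms(1) by (cases l) auto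
  have eq: "a div 2 ^ Suc k = b div 2 ^ Suc k" "b div 2 ^ Suc k = c div 2 ^ Suc k"
    using div_level[of a b] div_level[of b c] unfolding assms(1,2) k by this
  define q where "q = a div 2 ^ Suc k"
  have q: "q = a div 2 ^ Suc k" "q = b div 2 ^ Suc k" "q = c div 2 ^ Suc k"
    using eq by (simp_all only: q_def)
  have "level {a, b} = Suc k" "level {b, c} = Suc k" "level {c, d} = Suc k"
    using assms k by simp_all
  note halves = level_halves[OF this(1) q(1)] level_halves[OF this(2) q(2)]
    level_halves[OF this(3) q(3)]
  have less: "x < y" if "x div 2 ^ k = 2 * q" "y div 2 ^ k = 2 * q + 1" for x y
    using that by (intro less_of_div_less[of x "2 ^ k" y]) simp
  from halves(1) show ?thesis
  proof
    assume ab: "a div 2 ^ k = 2 * q \<and> b div 2 ^ k = 2 * q + 1"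
    then have c: "c div 2 ^ k = 2 * q" using halves(2) by linarith
    then have "d div 2 ^ k = 2 * q + 1" using halves(3) by linarith
    with ab c show ?thesis using less by blast
  next
    assume ab: "b div 2 ^ k = 2 * q \<and> a div 2 ^ k = 2 * q + 1"
    then have c: "c div 2 ^ k = 2 * q + 1" using halves(2) by linarith
    then have "d div 2 ^ k = 2 * q" using halves(3) by linarith
    with ab c show ?thesis using less by blast
  qed
qed

text \<open>Comparing sums of adjacent edges cancels the shared vertex, and distinctness makes the
  result strict. The last assumption is a disjunction to serve both directions of
  monotonicity.\<close>

lemma edges_cross_same_level:
  assumes "level {a, b} = l" "level {b, c} = l" "level {c, d} = l"
    and "a \<noteq> b" "a \<noteq> c" "b \<noteq> d"
    and "(a + b \<le> b + c \<and> b + c \<le> c + d) \<or> (c + d \<le> b + c \<and> b + c \<le> a + b)"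
  shows "edges_cross {parab a, parab b} {parab c, parab d}"
proof -
  have "(a < c \<and> b < d) \<or> (c < a \<and> d < b)" using assms(5-7) by auto
  with level_alternating[OF assms(1-4)]
  \<comment> \<open>The choice of lower half and the direction of the sums give four orders of the
    ends, all interleaved.\<close>
  consider "a < c" "c < b" "b < d" | "b < d" "d < a" "a < c"
    | "c < a" "a < d" "d < b" | "d < b" "b < c" "c < a" by linarith
  then show ?thesis
  proof cases
    case 1
    then show ?thesis by (rule edges_cross_parab)
  next
    case 2
    then show ?thesis using edges_cross_parab[of b d a c] by (simp add: insert_commute)
  next
    case 3
    then show ?thesis using edges_cross_parab[of c a d b] by (simp add: edges_cross_commute)
  next
    case 4
    then show ?thesis using edges_cross_parab[of d b c a] by (simp add: edges_cross_commute insert_commute)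
  qed
qed

section \<open>Ordering by keys, and counting along a path\<close>

text \<open>The order is lexicographic in \<open>k\<close>, \<open>s\<close> and an arbitrary
  injection \<open>g\<close>, which breaks ties and so gives antisymmetry.\<close>

lemma linear_order_on_refining_keys:
  fixes k s :: "'a \<Rightarrow> nat"
  assumes "finite E"
  obtains r where "linear_order_on E r"
    "\<And>e f. (e, f) \<in> r \<Longrightarrow> k e < k f \<or> (k e = k f \<and> s e \<le> s f)"
proof -
  obtain g :: "'a \<Rightarrow> nat" where g: "inj_on g E"
    using finite_imp_inj_to_nat_seg[OF assms] by blast
  let ?r = "{(e, f). e \<in> E \<and> f \<in> E \<and>
    (k e < k f \<or> (k e = k f \<and> (s e < s f \<or> (s e = s f \<and> g e \<le> g f))))}"
  have "linear_order_on E ?r"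
    unfolding linear_order_on_def partial_order_on_def preorder_on_def refl_on_def trans_def
      antisym_def total_on_def
    using g by (auto simp: inj_on_def)
  then show ?thesis by (rule that) auto
qed

text \<open>On even indices \<open>f\<close> gains at least 1 per step, so index
  \<open>2 * L\<close> would violate the bound. Applied to levels, it turns at most two edges per
  level into a length bound.\<close>

lemma length_le_of_two_step_increase:
  fixes f :: "nat \<Rightarrow> nat"
  assumes step: "\<And>i. i + 2 < m \<Longrightarrow> f i < f (i + 2)" and bound: "\<And>i. i < m \<Longrightarrow> f i < L"
  shows "m \<le> 2 * L"
proof (rule ccontr)
  assume m: "\<not> m \<le> 2 * L"
  have "2 * i < m \<Longrightarrow> i \<le> f (2 * i)" for i
  proof (induction i)
    case (Suc i)
    then show ?case using step[of "2 * i"] by simp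
  qed simp
  then have "L \<le> f (2 * L)" using m by simp
  then show False using bound[of "2 * L"] m by simp
qed

section \<open>The drawing and its edge-ordering\<close>

definition parab_graph :: "nat \<Rightarrow> point ugraph" where
  "parab_graph n = (parab ` {..<n}, (`) parab ` snd (complete_graph n))"

lemma straight_line_drawing_parab: "straight_line_drawing (parab_graph n) (complete_graph n)"
proof -
  have "parab ` e \<in> {{u, v} | u v. u \<in> parab ` {..<n} \<and> v \<in> parab ` {..<n} \<and> u \<noteq> v}"
    if "e \<in> snd (complete_graph n)" for e
  proof -
    obtain i j where "e = {i, j}" "i < n" "j < n" "i \<noteq> j"
      using \<open>e \<in> snd (complete_graph n)\<close> by (auto simp: complete_graph_def)
    then have "parab ` e = {parab i, parab j}" "parab i \<in> parab ` {..<n}"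
      "parab j \<in> parab ` {..<n}" "parab i \<noteq> parab j"
      by (simp_all add: inj_eq[OF inj_parab])
    then show ?thesis by blast
  qed
  then have "simple_graph (parab_graph n)"
    unfolding simple_graph_def parab_graph_def fst_conv snd_conv
    by (intro conjI image_subsetI) simp_all
  moreover have "general_position (fst (parab_graph n))"
    unfolding general_position_def parab_graph_def fst_conv
    by (simp add: inj_eq[OF inj_parab] not_collinear_parab)
  moreover have "graph_isomorphic (parab_graph n) (complete_graph n)"
    unfolding graph_isomorphic_def
  proof (intro exI conjI ballI)
    show "bij_betw (inv parab) (fst (parab_graph n)) (fst (complete_graph n))"
      by (auto simp: parab_graph_def complete_graph_def inj_parab
          intro!: bij_betw_byWitness[where f' = parab])
    fix u v assume "u \<in> fst (parab_graph n)" "v \<in> fst (parab_graph n)"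
    then obtain i j where ij: "u = parab i" "v = parab j" by (auto simp: parab_graph_def)
    have "{u, v} \<in> snd (parab_graph n) \<longleftrightarrow> parab ` {i, j} \<in> (`) parab ` snd (complete_graph n)"
      by (simp add: parab_graph_def ij)
    also have "\<dots> \<longleftrightarrow> {i, j} \<in> snd (complete_graph n)"
      by (rule inj_image_mem_iff[OF injI]) (simp only: inj_image_eq_iff[OF inj_parab])
    finally show "{u, v} \<in> snd (parab_graph n) \<longleftrightarrow> {inv parab u, inv parab v} \<in> snd (complete_graph n)"
      by (simp add: ij inj_parab)
  qed
  ultimately show ?thesis unfolding straight_line_drawing_def geometric_graph_def by simp
qed

text \<open>All vertices lie in one block of size \<open>2 ^ L\<close>, so only the levels from 1 to
  \<open>L\<close> occur.\<close>

lemma parab_graph_ordering: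
  assumes "n \<le> 2 ^ L"
  obtains r where "edge_ordering (parab_graph n) r"
    "\<And>p. p \<in> noncrossing_monotone_paths (parab_graph n) r \<Longrightarrow> path_length p \<le> 2 * L"
proof -
  let ?E = "snd (parab_graph n)"
  have "?E \<subseteq> Pow (fst (parab_graph n))"
    by (auto simp: parab_graph_def complete_graph_def)
  then have "finite ?E"
    by (rule finite_subset) (simp add: parab_graph_def)
  then obtain r where r: "linear_order_on ?E r"
    and key: "\<And>e f. (e, f) \<in> r \<Longrightarrow> level (inv parab ` e) < level (inv parab ` f) \<or>
      (level (inv parab ` e) = level (inv parab ` f) \<and> \<Sum>(inv parab ` e) \<le> \<Sum>(inv parab ` f))"
    using linear_order_on_refining_keys
      [of ?E "\<lambda>e. level (inv parab ` e)" "\<lambda>e. \<Sum>(inv parab ` e)"] by blast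
  have "path_length p \<le> 2 * L" if p: "p \<in> noncrossing_monotone_paths (parab_graph n) r" for p
  proof -
    have path: "path_in (parab_graph n) p" and nc: "noncrossing_path p" and mono: "monotone_path r p"
      using p by (auto simp: noncrossing_monotone_paths_def)
    have "p \<in> lists (parab ` {..<n})"
      using path by (auto simp: path_in_def parab_graph_def)
    \<comment> \<open>The path is pulled back to its list \<open>v\<close> of abscissas, where
      levels and sums are computed.\<close>
    then obtain v where pv: "p = map parab v" and "v \<in> lists {..<n}"
      unfolding lists_image by blast
    then have vL: "v ! i < 2 ^ L" if "i < length v" for i
      using less_le_trans[OF _ assms] nth_mem[OF that] by auto
    have dist: "distinct v" using path pv by (simp add: path_in_def distinct_map)
    let ?e = "\<lambda>i. {v ! i, v ! Suc i}"
    define m where "m = length v - 1"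
    have ne: "v ! i \<noteq> v ! j" if "i < length v" "j < length v" "i \<noteq> j" for i j
      using dist that by (simp add: nth_eq_iff_index_eq)
    have level_bounds: "0 < level (?e i)" "level (?e i) \<le> L" if "i < m" for i
    proof -
      show "0 < level (?e i)" using ne[of i "Suc i"] that by (intro level_pos) (auto simp: m_def)
      show "level (?e i) \<le> L"
        using that by (intro level_le vL) (auto simp: m_def)
    qed
    have edge: "path_edge p i = {parab (v ! i), parab (v ! Suc i)}" if "i < m" for i
      using that by (simp add: pv path_edge_def m_def)
    have key': "level (?e i) < level (?e j) \<or>
      (level (?e i) = level (?e j) \<and> v ! i + v ! Suc i \<le> v ! j + v ! Suc j)"
      if "edge_less r (path_edge p i) (path_edge p j)" "i < m" "j < m" for i j
    proof -
      \<comment> \<open>The sum ranges over a set, so the two ends must be distinct to be counted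
        separately.\<close>
      have "inv parab ` path_edge p k = ?e k" "\<Sum>(?e k) = v ! k + v ! Suc k" if "k < m" for k
        using edge[OF that] ne[of k "Suc k"] that by (auto simp: inj_parab m_def)
      with key[of "path_edge p i" "path_edge p j"] that show ?thesis
        by (simp add: edge_less_def)
    qed
    \<comment> \<open>Three consecutive edges of one level with monotone sums would make the first
      and third cross.\<close>
    have not_const: False
      if "i + 2 < m" "level (?e i) = l" "level (?e (Suc i)) = l" "level (?e (i + 2)) = l"
        "(v ! i + v ! Suc i \<le> v ! Suc i + v ! (i + 2) \<and> v ! Suc i + v ! (i + 2) \<le> v ! (i + 2) + v ! (i + 3)) \<or>
         (v ! (i + 2) + v ! (i + 3) \<le> v ! Suc i + v ! (i + 2) \<and> v ! Suc i + v ! (i + 2) \<le> v ! i + v ! Suc i)" for i l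
    proof -
      have "edges_cross {parab (v ! i), parab (v ! Suc i)} {parab (v ! (i + 2)), parab (v ! (i + 3))}"
        using that ne[of i "Suc i"] ne[of i "i + 2"] ne[of "Suc i" "i + 3"]
        by (intro edges_cross_same_level[where l = l])
          (auto simp: m_def numeral_eq_Suc)
      then have "edges_cross (path_edge p i) (path_edge p (i + 2))"
        using edge[of i] edge[of "i + 2"] that by (simp add: numeral_eq_Suc)
      moreover have "Suc i < length p" "Suc (i + 2) < length p"
        using that pv by (auto simp: m_def)
      ultimately show False
        using nc unfolding noncrossing_path_def by blast
    qed
    have idx: "Suc (Suc i) = i + 2" "Suc (i + 2) = i + 3" for i by simp_all
    have "m \<le> 2 * L"
    proof (cases "decreasing_path r p")
      case True
      then have less: "edge_less r (path_edge p i) (path_edge p (Suc i))" if "Suc i < m" for i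
        using that by (auto simp: decreasing_path_def pv m_def)
      have step: "level (?e i) < level (?e (i + 2))" if i: "i + 2 < m" for i
      proof -
        have "edge_less r (path_edge p i) (path_edge p (Suc i))" "edge_less r (path_edge p (Suc i)) (path_edge p (i + 2))"
          using less[of i] less[of "Suc i"] i by (auto simp: numeral_eq_Suc)
        from key'[OF this(1)] key'[OF this(2)] i have keys:
          "level (?e i) < level (?e (Suc i)) \<or> level (?e i) = level (?e (Suc i)) \<and>
            v ! i + v ! Suc i \<le> v ! (Suc i) + v ! Suc (Suc i)"
          "level (?e (Suc i)) < level (?e (i + 2)) \<or> level (?e (Suc i)) = level (?e (i + 2)) \<and>
            v ! (Suc i) + v ! Suc (Suc i) \<le> v ! (i + 2) + v ! Suc (i + 2)"
          by simp_all
        show ?thesis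
        \<comment> \<open>Levels are weakly increasing here, so without a strict rise all three are
          equal and the keys compare sums.\<close>
        proof (rule ccontr)
          assume "\<not> ?thesis"
          with keys have "level (?e (Suc i)) = level (?e i)" "level (?e (i + 2)) = level (?e i)"
            by linarith+
          with keys show False
            using not_const[OF i refl] unfolding idx by simp
        qed
      qed
      show ?thesis
      proof (rule length_le_of_two_step_increase)
        \<comment> \<open>Levels start at 1; the shift brings them strictly below
          \<open>L\<close>.\<close>
        show "level (?e i) - 1 < level (?e (i + 2)) - 1" if "i + 2 < m" for i
          using step[OF that] level_bounds[of i] that by simp
        show "level (?e i) - 1 < L" if "i < m" for i
          using level_bounds[OF that] by simp
      qed
    next
      case False
      then have "increasing_path r p" using mono by (simp add: monotone_path_def)
      then have less: "edge_less r (path_edge p (Suc i)) (path_edge p i)" if "Suc i < m" for i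
        using that by (auto simp: increasing_path_def pv m_def)
      have step: "level (?e (i + 2)) < level (?e i)" if i: "i + 2 < m" for i
      proof -
        have "edge_less r (path_edge p (Suc i)) (path_edge p i)" "edge_less r (path_edge p (i + 2)) (path_edge p (Suc i))"
          using less[of i] less[of "Suc i"] i by (auto simp: numeral_eq_Suc)
        from key'[OF this(1)] key'[OF this(2)] i have keys:
          "level (?e (Suc i)) < level (?e i) \<or> level (?e (Suc i)) = level (?e i) \<and>
            v ! (Suc i) + v ! Suc (Suc i) \<le> v ! i + v ! Suc i"
          "level (?e (i + 2)) < level (?e (Suc i)) \<or> level (?e (i + 2)) = level (?e (Suc i)) \<and>
            v ! (i + 2) + v ! Suc (i + 2) \<le> v ! (Suc i) + v ! Suc (Suc i)"
          by simp_all
        show ?thesis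
        proof (rule ccontr)
          assume "\<not> ?thesis"
          with keys have "level (?e (Suc i)) = level (?e i)" "level (?e (i + 2)) = level (?e i)"
            by linarith+
          with keys show False
            using not_const[OF i refl] unfolding idx by simp
        qed
      qed
      show ?thesis
      proof (rule length_le_of_two_step_increase)
        \<comment> \<open>Levels fall along the path in this case, so they are counted down from
          \<open>L\<close>; positivity keeps the difference below \<open>L\<close>.\<close>
        show "L - level (?e i) < L - level (?e (i + 2))" if "i + 2 < m" for i
          using step[OF that] level_bounds[of i] that by simp
        show "L - level (?e i) < L" if "i < m" for i
          using level_bounds[OF that] by simp
      qed
    qed
    then show ?thesis by (simp add: path_length_def pv m_def)
  qed
  with r that show ?thesis unfolding edge_ordering_def by blast
qed

section \<open>From levels to the logarithmic bound\<close>

lemma dyadic_upper_bound: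
  assumes "2 \<le> n"
  obtains L where "n \<le> 2 ^ L" "real L \<le> 2 * log 2 (real n)"
proof
  let ?L = "nat \<lceil>log 2 (real n)\<rceil>"
  have ge1: "1 \<le> log 2 (real n)" using assms by simp
  then have L: "real ?L = of_int \<lceil>log 2 (real n)\<rceil>" by simp
  have "real n = 2 powr log 2 (real n)" using assms by simp
  also have "\<dots> \<le> 2 powr real ?L" by (intro powr_mono) (auto simp: L)
  also have "\<dots> = real (2 ^ ?L)" by (simp add: powr_realpow)
  finally show "n \<le> 2 ^ ?L" by (simp only: of_nat_le_iff)
  \<comment> \<open>Rounding up adds less than 1, which is at most \<open>log 2 (real n)\<close>
    since \<open>n\<close> is at least 2.\<close>
  show "real ?L \<le> 2 * log 2 (real n)" unfolding L using ge1 by linarith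
qed

lemma alpha_bar_le:
  assumes D: "straight_line_drawing D G" and r: "edge_ordering D r" and ne: "fst D \<noteq> {}"
    and bound: "\<And>p. p \<in> noncrossing_monotone_paths D r \<Longrightarrow> path_length p \<le> M"
  shows "alpha_bar G \<le> M"
proof -
  \<comment> \<open>The one-vertex path makes the set of paths nonempty, as
    \<open>cSUP_least\<close> requires.\<close>
  obtain x where "x \<in> fst D" using ne by blast
  then have "[x] \<in> noncrossing_monotone_paths D r"
    by (auto simp: noncrossing_monotone_paths_def path_in_def noncrossing_path_def
        monotone_path_def increasing_path_def)
  then have "(SUP p\<in>noncrossing_monotone_paths D r. path_length p) \<le> M"
    using bound by (intro cSUP_least) auto
  moreover have "alpha_bar_geometric D \<le> (SUP p\<in>noncrossing_monotone_paths D r. path_length p)"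
    unfolding alpha_bar_geometric_def using r by (intro cINF_lower) auto
  moreover have "alpha_bar G \<le> alpha_bar_geometric D"
    unfolding alpha_bar_def using D by (intro cINF_lower) auto
  ultimately show ?thesis by linarith
qed

theorem theorem2:
  "(\<lambda>n. real (alpha_bar (complete_graph n))) \<in> O(\<lambda>n. ln (real n)) \<and>
   (\<exists>C::real. \<forall>n\<ge>2. \<exists>D r.
      straight_line_drawing D (complete_graph n) \<and> edge_ordering D r \<and>
      (\<forall>p\<in>noncrossing_monotone_paths D r. real (path_length p) \<le> C * ln (real n)))"
proof -
  \<comment> \<open>Paths have length at most \<open>2 * L\<close>, and \<open>L\<close> is at most
    \<open>2 * log 2 (real n)\<close>; the factor \<open>1 / ln 2\<close> changes the base.\<close>
  define C :: real where "C = 4 / ln 2"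
  have main: "\<exists>r. edge_ordering (parab_graph n) r \<and>
      (\<forall>p\<in>noncrossing_monotone_paths (parab_graph n) r. real (path_length p) \<le> C * ln (real n)) \<and>
      real (alpha_bar (complete_graph n)) \<le> C * ln (real n)" if n: "2 \<le> n" for n
  proof -
    obtain L where L: "n \<le> 2 ^ L" "real L \<le> 2 * log 2 (real n)"
      using dyadic_upper_bound[OF n] .
    obtain r where r: "edge_ordering (parab_graph n) r"
      and len: "\<And>p. p \<in> noncrossing_monotone_paths (parab_graph n) r \<Longrightarrow> path_length p \<le> 2 * L"
      using parab_graph_ordering[OF L(1)] by blast
    have "fst (parab_graph n) \<noteq> {}" using n by (simp add: parab_graph_def lessThan_empty_iff)
    then have "alpha_bar (complete_graph n) \<le> 2 * L"
      using alpha_bar_le[OF straight_line_drawing_parab r] len by blast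
    moreover have "real x \<le> C * ln (real n)" if "x \<le> 2 * L" for x
    proof -
      have "real x \<le> 2 * real L" using that by linarith
      with L(2) have "real x \<le> 4 * log 2 (real n)" by linarith
      then show ?thesis by (simp add: C_def log_def)
    qed
    ultimately show ?thesis using r len by blast
  qed
  have "eventually (\<lambda>n. norm (real (alpha_bar (complete_graph n))) \<le> C * norm (ln (real n))) at_top"
    using eventually_ge_at_top[of "2::nat"]
  proof eventually_elim
    case (elim n)
    then show ?case using main[of n] by (auto simp: abs_of_nonneg)
  qed
  then have "(\<lambda>n. real (alpha_bar (complete_graph n))) \<in> O(\<lambda>n. ln (real n))"
    by (rule bigoI)
  then show ?thesis using main straight_line_drawing_parab by blast
qed

end
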